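(* For every integer $n\ge 0$ let $\overline{T_n}$ be the $n$-foil knot with generating polynomial $\overline{T_n}(x)$, and let $T_n(x)$ be the generating polynomial of the $n$-twist loop $T_n$. Then $$\overline{T_n}(x)=\overline{T_{n-1}}(x)+T_{n-1}(x)\qquad (n\ge 1),$$ and $\overline{T_n}(x)$ is given by the closed form $$\overline{T_n}(x)=(x+1)^n+x^2-1\qquad (n\ge 0).$$
   Context: A knot (diagram) means a shadow on the sphere $S^2$: a finite collection of closed curves whose only singularities are finitely many transverse double points, called crossings, with no over/under information, considered up to planar isotopy (several components and crossingless circles are allowed). The unknot $U$ is a single simple closed curve. Each crossing can be split in two ways: remove the crossing and reconnect the four ends in one of the two planar non-crossing ways that join adjacent ends (type $0$ and type $1$ splits). A state of a knot $K$ with $m$ crossings is one of the $2^m$ diagrams obtained by choosing a split at each crossing; it is a disjoint union of simple closed curves (circles), and $|S|$ denotes the number of circles of the state $S$. The generating polynomial of $K$ is $K(x)=\sum_S x^{|S|}$, summed over all $2^m$ states. Consider the diagram in a disc with four boundary ends NW, SW (left) and NE, SE (right) given by $n$ crossings in a horizontal row, the two right ends of each crossing being joined to the two left ends of the next (upper to upper, lower to lower); for $n=0$ it consists of two disjoint horizontal strands NW–NE and SW–SE. The $n$-twist loop $T_n$ is obtained by joining, outside the disc and without crossings, NW to SW and NE to SE ($T_0=U$). The $n$-foil knot $\overline{T_n}$, the closure of $T_n$, is obtained by instead joining, outside the disc by disjoint simple arcs, NW to NE and SW to SE (that is, the shadow of the closed two-strand braid with $n$ crossings; $\overline{T_0}$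 is two disjoint circles). *)

theory Defs
  imports "HOL-Library.FuncSet" "HOL-Computational_Algebra.Polynomial"
begin

text \<open>
  A shadow is encoded as a planar-diagram code without over/under information. The \<open>edges\<close> are
  labels of the arcs of the diagram, and \<open>inc D c k\<close> is the arc that leaves the crossing \<open>c\<close> at its
  corner \<open>k\<close>. The four corners of a crossing are listed in their cyclic order, so that \<open>NW\<close>/\<open>SE\<close>
  and \<open>NE\<close>/\<open>SW\<close> are the two transverse branches. In a closed diagram an arc has either two ends at
  crossings or none; an arc without ends is a crossingless circle. That the code can be drawn on the
  sphere is not part of \<open>closed_diagram\<close>: states and circle counts do not depend on it.
\<close>

datatype corner = NW | NE | SE | SW

record ('c, 'e) diagram =
  crossings :: "'c set"
  edges :: "'e set"
  inc :: "'c \<Rightarrow> corner \<Rightarrow> 'e"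

text \<open>
  A diagram in a disc with four boundary ends: \<open>bdry T k\<close> is the arc that reaches the boundary
  point \<open>k\<close>. Here every arc has two or no ends, counting the boundary ends as well.
\<close>

record ('c, 'e) tangle = "('c, 'e) diagram" +
  bdry :: "corner \<Rightarrow> 'e"

definition ends :: "('c, 'e, 'z) diagram_scheme \<Rightarrow> 'e \<Rightarrow> ('c \<times> corner) set" where
  "ends D e = {(c, k). c \<in> crossings D \<and> inc D c k = e}"

definition closed_diagram :: "('c, 'e) diagram \<Rightarrow> bool" where
  "closed_diagram D \<longleftrightarrow> finite (crossings D) \<and> finite (edges D) \<and>
     (\<forall>c\<in>crossings D. \<forall>k. inc D c k \<in> edges D) \<and>
     (\<forall>e\<in>edges D. ends D e = {} \<or> card (ends D e) = 2)"

definition disc_diagram :: "('c, 'e) tangle \<Rightarrow> bool" where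
  "disc_diagram T \<longleftrightarrow> finite (crossings T) \<and> finite (edges T) \<and>
     (\<forall>c\<in>crossings T. \<forall>k. inc T c k \<in> edges T) \<and> range (bdry T) \<subseteq> edges T \<and>
     (\<forall>e\<in>edges T. card (ends T e) + card {k. bdry T k = e} \<in> {0, 2})"


subsection \<open>Joining arcs\<close>

text \<open>
  The pairs in \<open>J\<close> say which arcs are connected to each other; the arcs of the resulting diagram are
  the classes of the equivalence relation generated by \<open>J\<close>. An arc whose two ends are joined to each
  other keeps its label, but no end of it remains, i.e. it becomes a circle.
\<close>

definition joined :: "'e set \<Rightarrow> ('e \<times> 'e) set \<Rightarrow> ('e \<times> 'e) set" where
  "joined E J = {(x, y). x \<in> E \<and> y \<in> E \<and> (x, y) \<in> (J \<union> J\<inverse>)\<^sup>*}"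

definition join :: "('c, 'e, 'z) diagram_scheme \<Rightarrow> ('e \<times> 'e) set \<Rightarrow> ('c, 'e set) diagram" where
  "join D J = \<lparr>crossings = crossings D, edges = edges D // joined (edges D) J,
     inc = (\<lambda>c k. joined (edges D) J `` {inc D c k})\<rparr>"

text \<open>
  The outside of the disc: boundary points are joined in pairs. If the pairing is by adjacent
  points, the outer arcs can be drawn without crossings.
\<close>

definition close_up :: "('c, 'e) tangle \<Rightarrow> (corner \<times> corner) set \<Rightarrow> ('c, 'e set) diagram" where
  "close_up T P = join T ((\<lambda>(a, b). (bdry T a, bdry T b)) ` P)"


subsection \<open>States and the generating polynomial\<close>

datatype split_type = Type0 | Type1

fun split_pairs :: "split_type \<Rightarrow> (corner \<times> corner) set" where
  "split_pairs Type0 = {(NW, NE), (SW, SE)}"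
| "split_pairs Type1 = {(NW, SW), (NE, SE)}"

definition state :: "('c, 'e) diagram \<Rightarrow> ('c \<Rightarrow> split_type) \<Rightarrow> ('c, 'e set) diagram" where
  "state D s =
     (join D (\<Union>c\<in>crossings D. (\<lambda>(a, b). (inc D c a, inc D c b)) ` split_pairs (s c)))
       \<lparr>crossings := {}\<rparr>"

text \<open>A diagram without crossings consists of circles only, one for each arc label.\<close>

definition num_circles :: "('c, 'e) diagram \<Rightarrow> nat" where
  "num_circles S = card (edges S)"

text \<open>
  The sum is indexed by the choices of splits, since different choices may give equal states.
\<close>

definition gen_poly :: "('c, 'e) diagram \<Rightarrow> int poly" where
  "gen_poly D = (\<Sum>s \<in> crossings D \<rightarrow>\<^sub>E UNIV. monom 1 (num_circles (state D s)))"


subsection \<open>The horizontal row of crossings and its two closures\<close>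

text \<open>
  The crossings are \<open>0, \<dots>, n - 1\<close> from left to right. The arc \<open>(Upper, i)\<close> or \<open>(Lower, i)\<close> is to
  the left of crossing \<open>i\<close> and to the right of crossing \<open>i - 1\<close>.
\<close>

datatype level = Upper | Lower

fun row_inc :: "nat \<Rightarrow> corner \<Rightarrow> level \<times> nat" where
  "row_inc i NW = (Upper, i)"
| "row_inc i SW = (Lower, i)"
| "row_inc i NE = (Upper, Suc i)"
| "row_inc i SE = (Lower, Suc i)"

fun row_bdry :: "nat \<Rightarrow> corner \<Rightarrow> level \<times> nat" where
  "row_bdry n NW = (Upper, 0)"
| "row_bdry n SW = (Lower, 0)"
| "row_bdry n NE = (Upper, n)"
| "row_bdry n SE = (Lower, n)"

definition row :: "nat \<Rightarrow> (nat, level \<times> nat) tangle" where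
  "row n = \<lparr>crossings = {..<n}, edges = UNIV \<times> {..n}, inc = row_inc, bdry = row_bdry n\<rparr>"

definition twist_loop :: "nat \<Rightarrow> (nat, (level \<times> nat) set) diagram" where
  "twist_loop n = close_up (row n) {(NW, SW), (NE, SE)}"

definition foil :: "nat \<Rightarrow> (nat, (level \<times> nat) set) diagram" where
  "foil n = close_up (row n) {(NW, NE), (SW, SE)}"


subsection \<open>The encodings are well-formed\<close>

lemma UNIV_level: "UNIV = {Upper, Lower}"
  using level.exhaust by auto

lemma UNIV_corner: "UNIV = {NW, NE, SE, SW}"
  using corner.exhaust by auto

lemma all_corner: "(\<forall>k. P k) \<longleftrightarrow> P NW \<and> P NE \<and> P SE \<and> P SW"
  by (metis corner.exhaust)

lemma ends_row:
  assumes "i \<le> n"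
  shows "ends (row n) (Upper, i) =
      (if i < n then {(i, NW)} else {}) \<union> (if 0 < i then {(i - 1, NE)} else {})"
    and "ends (row n) (Lower, i) =
      (if i < n then {(i, SW)} else {}) \<union> (if 0 < i then {(i - 1, SE)} else {})"
proof -
  show "ends (row n) (Upper, i) =
      (if i < n then {(i, NW)} else {}) \<union> (if 0 < i then {(i - 1, NE)} else {})"
    (is "_ = ?A")
  proof (intro set_eqI, clarify)
    show "(c, k) \<in> ends (row n) (Upper, i) \<longleftrightarrow> (c, k) \<in> ?A" for c k
      using assms by (cases k) (auto simp: ends_def row_def)
  qed
  show "ends (row n) (Lower, i) =
      (if i < n then {(i, SW)} else {}) \<union> (if 0 < i then {(i - 1, SE)} else {})"
    (is "_ = ?A")
  proof (intro set_eqI, clarify)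
    show "(c, k) \<in> ends (row n) (Lower, i) \<longleftrightarrow> (c, k) \<in> ?A" for c k
      using assms by (cases k) (auto simp: ends_def row_def)
  qed
qed

lemma bdry_row:
  "{k. row_bdry n k = (Upper, i)} = (if i = 0 then {NW} else {}) \<union> (if i = n then {NE} else {})"
  "{k. row_bdry n k = (Lower, i)} = (if i = 0 then {SW} else {}) \<union> (if i = n then {SE} else {})"
proof -
  show "{k. row_bdry n k = (Upper, i)} =
      (if i = 0 then {NW} else {}) \<union> (if i = n then {NE} else {})" (is "_ = ?A")
  proof (intro set_eqI)
    show "k \<in> {k. row_bdry n k = (Upper, i)} \<longleftrightarrow> k \<in> ?A" for k
      by (cases k) auto
  qed
  show "{k. row_bdry n k = (Lower, i)} =
      (if i = 0 then {SW} else {}) \<union> (if i = n then {SE} else {})" (is "_ = ?A")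
  proof (intro set_eqI)
    show "k \<in> {k. row_bdry n k = (Lower, i)} \<longleftrightarrow> k \<in> ?A" for k
      by (cases k) auto
  qed
qed

lemma disc_diagram_row: "disc_diagram (row n)"
proof -
  have "card (ends (row n) e) + card {k. bdry (row n) k = e} = 2" if "e \<in> edges (row n)" for e
  proof -
    obtain l i where e: "e = (l, i)" "i \<le> n"
      using \<open>e \<in> edges (row n)\<close> by (cases e) (auto simp: row_def)
    have b: "bdry (row n) = row_bdry n"
      by (simp add: row_def)
    show ?thesis
      using e unfolding b by (cases l) (auto simp: ends_row bdry_row)
  qed
  moreover have "inc (row n) c k \<in> edges (row n)" if "c \<in> crossings (row n)" for c k
    using that by (cases k) (auto simp: row_def)
  moreover have "bdry (row n) k \<in> edges (row n)" for k
    by (cases k) (auto simp: row_def)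
  moreover have "finite (crossings (row n))" "finite (edges (row n))"
    by (simp_all add: row_def finite_cartesian_product UNIV_level)
  ultimately show ?thesis
    unfolding disc_diagram_def by blast
qed

lemma joined_kernel:
  assumes "\<And>x y. (x, y) \<in> J \<Longrightarrow> f x = f y"
    and "\<And>x. (x, f x) \<in> (J \<union> J\<inverse>)\<^sup>*"
  shows "joined E J = {(x, y). x \<in> E \<and> y \<in> E \<and> f x = f y}"
proof -
  have "f x = f y" if "(x, y) \<in> (J \<union> J\<inverse>)\<^sup>*" for x y
    using that by induction (use assms(1) in force)+
  moreover have "(x, y) \<in> (J \<union> J\<inverse>)\<^sup>*" if "f x = f y" for x y
  proof -
    have "sym ((J \<union> J\<inverse>)\<^sup>*)"
      by (intro sym_rtrancl sym_Un_converse)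
    then have "(f y, y) \<in> (J \<union> J\<inverse>)\<^sup>*"
      using assms(2)[of y] by (auto dest: symD)
    with assms(2)[of x] that show ?thesis
      by (auto intro: rtrancl_trans)
  qed
  ultimately show ?thesis
    unfolding joined_def by blast
qed

lemma closed_diagram_join:
  assumes K: "joined (edges D) J = {(x, y). x \<in> edges D \<and> y \<in> edges D \<and> f x = f y}"
    and "finite (crossings D)" "finite (edges D)"
    and I: "\<And>c k. c \<in> crossings D \<Longrightarrow> inc D c k \<in> edges D"
    and C: "\<And>e. e \<in> edges D \<Longrightarrow>
        {(c, k). c \<in> crossings D \<and> f (inc D c k) = f e} = {} \<or>
        card {(c, k). c \<in> crossings D \<and> f (inc D c k) = f e} = 2"
  shows "closed_diagram (join D J)"
proof -
  define R where "R = joined (edges D) J"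
  have R: "R `` {x} = R `` {y} \<longleftrightarrow> f x = f y" if "x \<in> edges D" "y \<in> edges D" for x y
    using that unfolding R_def K by auto
  have "ends (join D J) X = {} \<or> card (ends (join D J) X) = 2" if X: "X \<in> edges (join D J)" for X
  proof -
    obtain e where e: "e \<in> edges D" "X = R `` {e}"
      using X by (auto simp: join_def R_def quotient_def)
    have "ends (join D J) X = {(c, k). c \<in> crossings D \<and> f (inc D c k) = f e}"
      using R I e by (auto simp: ends_def join_def R_def[symmetric])
    with C[OF e(1)] show ?thesis
      by simp
  qed
  moreover have "finite (edges D // R)"
    using assms(3) by (simp add: quotient_def)
  ultimately show ?thesis
    using assms(2) I by (auto simp: closed_diagram_def join_def R_def intro: quotientI)
qed

lemma closed_diagram_twist_loop: "closed_diagram (twist_loop n)"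
proof -
  define J where "J = (\<lambda>(a, b). (bdry (row n) a, bdry (row n) b)) ` {(NW, SW), (NE, SE)}"
  have J: "J = {((Upper, 0), (Lower, 0)), ((Upper, n), (Lower, n))}"
    by (simp add: J_def row_def)
  define f where "f = (\<lambda>(l, i). if i = 0 \<or> i = n then (Upper, i) else (l, i))"
  have K: "joined (edges (row n)) J =
      {(x, y). x \<in> edges (row n) \<and> y \<in> edges (row n) \<and> f x = f y}"
  proof (rule joined_kernel)
    show "(x, f x) \<in> (J \<union> J\<inverse>)\<^sup>*" for x
      by (cases x; cases "fst x") (auto simp: f_def J)
  qed (auto simp: J f_def)
  have C: "card {(c, k). c \<in> {..<n} \<and> f (row_inc c k) = f (l, i)} = 2"
    if "0 < n" "i \<le> n" for l i
  proof -
    have "{(c, k). c \<in> {..<n} \<and> f (row_inc c k) = f (l, i)} =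
      (if i = 0 then {(0, NW), (0, SW)} else if i = n then {(n - 1, NE), (n - 1, SE)}
       else if l = Upper then {(i, NW), (i - 1, NE)} else {(i, SW), (i - 1, SE)})"
      (is "_ = ?A")
    proof (intro set_eqI, clarify)
      show "(c, k) \<in> {(c, k). c \<in> {..<n} \<and> f (row_inc c k) = f (l, i)} \<longleftrightarrow> (c, k) \<in> ?A" for c k
        using that by (cases k; cases l) (auto simp: f_def)
    qed
    then show ?thesis
      using that by simp
  qed
  show ?thesis
    unfolding twist_loop_def close_up_def J_def[symmetric]
  proof (rule closed_diagram_join[OF K])
    show "{(c, k). c \<in> crossings (row n) \<and> f (inc (row n) c k) = f e} = {} \<or>
        card {(c, k). c \<in> crossings (row n) \<and> f (inc (row n) c k) = f e} = 2"
      if "e \<in> edges (row n)" for e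
      using that C[of "snd e" "fst e"] by (cases "n = 0") (auto simp: row_def)
  qed (use disc_diagram_row[of n] in \<open>auto simp: disc_diagram_def\<close>)
qed

lemma closed_diagram_foil: "closed_diagram (foil n)"
proof -
  define J where "J = (\<lambda>(a, b). (bdry (row n) a, bdry (row n) b)) ` {(NW, NE), (SW, SE)}"
  have J: "J = {((Upper, 0), (Upper, n)), ((Lower, 0), (Lower, n))}"
    by (simp add: J_def row_def)
  define f where "f = (\<lambda>(l :: level, i). if i = n then (l, 0) else (l, i))"
  have K: "joined (edges (row n)) J =
      {(x, y). x \<in> edges (row n) \<and> y \<in> edges (row n) \<and> f x = f y}"
  proof (rule joined_kernel)
    show "(x, f x) \<in> (J \<union> J\<inverse>)\<^sup>*" for x
      by (cases x; cases "fst x") (auto simp: f_def J)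
  qed (auto simp: J f_def)
  have C: "card {(c, k). c \<in> {..<n} \<and> f (row_inc c k) = f (l, i)} = 2"
    if "0 < n" "i \<le> n" for l i
  proof -
    have "{(c, k). c \<in> {..<n} \<and> f (row_inc c k) = f (l, i)} =
      (if l = Upper then {(if i = n then 0 else i, NW), (if i = 0 then n - 1 else i - 1, NE)}
       else {(if i = n then 0 else i, SW), (if i = 0 then n - 1 else i - 1, SE)})"
      (is "_ = ?A")
    proof (intro set_eqI, clarify)
      show "(c, k) \<in> {(c, k). c \<in> {..<n} \<and> f (row_inc c k) = f (l, i)} \<longleftrightarrow> (c, k) \<in> ?A" for c k
        using that by (cases k; cases l) (auto simp: f_def)
    qed
    then show ?thesis
      by simp
  qed
  show ?thesis
    unfolding foil_def close_up_def J_def[symmetric]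
  proof (rule closed_diagram_join[OF K])
    show "{(c, k). c \<in> crossings (row n) \<and> f (inc (row n) c k) = f e} = {} \<or>
        card {(c, k). c \<in> crossings (row n) \<and> f (inc (row n) c k) = f e} = 2"
      if "e \<in> edges (row n)" for e
      using that C[of "snd e" "fst e"] by (cases "n = 0") (auto simp: row_def)
  qed (use disc_diagram_row[of n] in \<open>auto simp: disc_diagram_def\<close>)
qed

end

theory Submission
  imports Defs
begin

text \<open>
  Split every crossing of the row, and call a crossing a cut if its split is \<open>Type1\<close>. A split of
  \<open>Type0\<close> only prolongs the two strands, whereas a cut caps off both of them on its left and starts
  them anew on its right. So \<open>k\<close> cuts divide the row into \<open>k + 1\<close> stretches. In the twist loop the
  outer arcs cap off the first and the last stretch, every stretch becomes one circle, and the state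
  has \<open>k + 1\<close> circles. In the foil the outer arcs glue the last stretch to the first one, which
  leaves \<open>k\<close> circles, except that without any cut the two strands close up separately to two circles.
  By the binomial theorem, in the form \<open>(x + 1)^n = \<Sum>\<^sub>s x^(cuts of s)\<close>, the polynomials are
  \<open>x (x + 1)^n\<close> for the twist loop and \<open>(x + 1)^n\<close> for the foil, the latter with a correction of
  \<open>x^2 - 1\<close> for the one state without cuts. The correction does not depend on \<open>n\<close>, so the recursion
  is \<open>(x + 1)^n = (x + 1)^(n - 1) + x (x + 1)^(n - 1)\<close>.

  The circles of a state are classes of arcs, so counting them means finding a complete invariant of
  the classes (\<open>card_joined_classes\<close>). The invariant of an arc is the number of cuts to its left,
  taken modulo \<open>k\<close> in the foil; in the foil without cuts it is the level of the arc.
\<close>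

section \<open>Classes of joined arcs\<close>

lemma equiv_joined: "equiv E (joined E J)"
proof (rule equivI)
  have "sym ((J \<union> J\<inverse>)\<^sup>*)"
    by (intro sym_rtrancl sym_Un_converse)
  then show "sym (joined E J)"
    unfolding joined_def sym_def by blast
  show "trans (joined E J)"
    unfolding joined_def trans_def by (auto intro: rtrancl_trans)
qed (auto simp: joined_def refl_on_def)

lemma joined_base: "(x, y) \<in> J \<Longrightarrow> x \<in> E \<Longrightarrow> y \<in> E \<Longrightarrow> (x, y) \<in> joined E J"
  by (auto simp: joined_def)

lemma joined_invariant:
  assumes "(x, y) \<in> joined E J" and "\<And>u v. (u, v) \<in> J \<Longrightarrow> f u = f v"
  shows "f x = f y"
proof -
  have "(x, y) \<in> (J \<union> J\<inverse>)\<^sup>*"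
    using assms(1) by (simp add: joined_def)
  then show ?thesis
    by induction (use assms(2) in force)+
qed

lemma card_joined_classes:
  assumes "\<And>x y. (x, y) \<in> J \<Longrightarrow> f x = f y"
    and "\<And>x y. x \<in> E \<Longrightarrow> y \<in> E \<Longrightarrow> f x = f y \<Longrightarrow> (x, y) \<in> joined E J"
  shows "card (E // joined E J) = card (f ` E)"
proof -
  let ?R = "joined E J"
  have f_iff: "?R `` {x} = ?R `` {y} \<longleftrightarrow> f x = f y" if "x \<in> E" "y \<in> E" for x y
    using that assms joined_invariant[of x y E J f] eq_equiv_class_iff[OF equiv_joined that]
    by blast
  have elem: "the_elem (f ` (?R `` {x})) = f x" if "x \<in> E" for x
  proof -
    have "f ` (?R `` {x}) = {f x}"
      using joined_invariant[of x _ E J f] assms(1) equiv_class_self[OF equiv_joined that]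
      by (auto 0 3)
    then show ?thesis by simp
  qed
  have "bij_betw (\<lambda>X. the_elem (f ` X)) (E // ?R) (f ` E)"
    unfolding bij_betw_def
  proof
    show "inj_on (\<lambda>X. the_elem (f ` X)) (E // ?R)"
      using f_iff by (auto simp: inj_on_def quotient_def elem)
    show "(\<lambda>X. the_elem (f ` X)) ` (E // ?R) = f ` E"
      by (force simp: quotient_def elem image_iff)
  qed
  then show ?thesis
    by (rule bij_betw_same_card)
qed

text \<open>
  The arcs of a closure are already classes, and those of its states are classes of classes. Joining
  in two stages amounts to joining everything at once, so the closure and the splits can be treated
  on the same footing. A path of joins that starts in \<open>E\<close> stays in \<open>E\<close> because all joins do; its
  \<open>J\<close>-steps stay within one class, and its \<open>M\<close>-steps are steps between classes. Conversely, two
  consecutive steps between classes are linked inside the common class by a path of \<open>J\<close>-steps.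
\<close>

lemma joined_classes_iff:
  assumes J: "J \<subseteq> E \<times> E" and M: "M \<subseteq> E \<times> E" and x: "x \<in> E" and y: "y \<in> E"
  defines "c \<equiv> \<lambda>x. joined E J `` {x}"
  shows "(c x, c y) \<in> joined (E // joined E J) (map_prod c c ` M) \<longleftrightarrow> (x, y) \<in> joined E (J \<union> M)"
proof -
  let ?M = "map_prod c c ` M" and ?K = "J \<union> M"
  have c_eq: "c u = c v \<longleftrightarrow> (u, v) \<in> joined E J" if "u \<in> E" "v \<in> E" for u v
    using eq_equiv_class_iff[OF equiv_joined that] unfolding c_def .
  have mono: "(u, v) \<in> joined E ?K" if "(u, v) \<in> joined E J" for u v
  proof -
    have "(J \<union> J\<inverse>)\<^sup>* \<subseteq> (?K \<union> ?K\<inverse>)\<^sup>*"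
      by (intro rtrancl_mono) auto
    then show ?thesis
      using that by (auto simp: joined_def)
  qed
  note equiv = equiv_joined[of E ?K]
  have lift: "v \<in> E \<and> (c u, c v) \<in> (?M \<union> ?M\<inverse>)\<^sup>*" if "u \<in> E" "(u, v) \<in> (?K \<union> ?K\<inverse>)\<^sup>*" for u v
    using that(2)
  proof induction
    case (step v w)
    have "w \<in> E"
      using step J M by auto
    have "c v = c w \<or> (c v, c w) \<in> ?M \<union> ?M\<inverse>"
    proof (cases "(v, w) \<in> M \<union> M\<inverse>")
      case False
      then have "(v, w) \<in> J \<union> J\<inverse>"
        using step by auto
      then have "c v = c w"
        using step \<open>w \<in> E\<close> by (subst c_eq) (auto simp: joined_def)
      then show ?thesis ..
    qed (auto intro: rev_image_eqI)
    then have "(c u, c w) \<in> (?M \<union> ?M\<inverse>)\<^sup>*"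
      using step.IH rtrancl_into_rtrancl[of "c u" "c v" "?M \<union> ?M\<inverse>" "c w"] by metis
    then show ?case
      using \<open>w \<in> E\<close> by blast
  qed (use that in auto)
  have descend: "\<exists>v\<in>E. V = c v \<and> (u, v) \<in> joined E ?K"
    if "u \<in> E" "(c u, V) \<in> (?M \<union> ?M\<inverse>)\<^sup>*" for u V
    using that(2)
  proof induction
    case base
    then show ?case
      using that(1) by (auto simp: joined_def)
  next
    case (step V W)
    then obtain v where v: "v \<in> E" "V = c v" "(u, v) \<in> joined E ?K"
      by blast
    obtain p q where pq: "(p, q) \<in> M \<union> M\<inverse>" "V = c p" "W = c q"
      using step by auto
    have "p \<in> E" "q \<in> E"
      using pq M by auto
    moreover from this have "(p, q) \<in> joined E ?K"
      using pq by (auto simp: joined_def)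
    moreover have "(v, p) \<in> joined E ?K"
      using mono c_eq[of v p] v(1,2) pq(2) \<open>p \<in> E\<close> by metis
    ultimately have "(u, q) \<in> joined E ?K"
      using equivE[OF equiv] v(3) by (metis transD)
    then show ?case
      using \<open>q \<in> E\<close> pq by blast
  qed
  show ?thesis
  proof
    assume "(c x, c y) \<in> joined (E // joined E J) ?M"
    then obtain v where "v \<in> E" "c y = c v" "(x, v) \<in> joined E ?K"
      using descend[OF x] by (auto simp: joined_def)
    moreover have "(v, y) \<in> joined E ?K"
      using mono c_eq[of v y] calculation y by auto
    ultimately show "(x, y) \<in> joined E ?K"
      using equivE[OF equiv] by (metis transD)
  next
    assume "(x, y) \<in> joined E ?K"
    then have "(c x, c y) \<in> (?M \<union> ?M\<inverse>)\<^sup>*"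
      using lift[OF x, of y] by (simp add: joined_def)
    moreover have "c x \<in> E // joined E J" "c y \<in> E // joined E J"
      using x y by (simp_all add: c_def quotientI)
    ultimately show "(c x, c y) \<in> joined (E // joined E J) ?M"
      unfolding joined_def[of "E // joined E J"] by simp
  qed
qed

lemma card_iterated_quotient:
  assumes "J \<subseteq> E \<times> E" "M \<subseteq> E \<times> E"
  defines "c \<equiv> \<lambda>x. joined E J `` {x}"
  shows "card ((E // joined E J) // joined (E // joined E J) (map_prod c c ` M)) =
    card (E // joined E (J \<union> M))"
proof -
  let ?Q = "E // joined E J"
  let ?S = "joined ?Q (map_prod c c ` M)"
  have "card (E // joined E (J \<union> M)) = card ((\<lambda>x. ?S `` {c x}) ` E)"
  proof (rule card_joined_classes)
    have iff: "?S `` {c x} = ?S `` {c y} \<longleftrightarrow> (x, y) \<in> joined E (J \<union> M)" if "x \<in> E" "y \<in> E" for x y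
      using that joined_classes_iff[OF assms(1,2) that]
        eq_equiv_class_iff[OF equiv_joined, of "c x" ?Q "c y"]
      unfolding c_def by (auto intro: quotientI)
    show "?S `` {c x} = ?S `` {c y}" if "(x, y) \<in> J \<union> M" for x y
    proof -
      have "x \<in> E" "y \<in> E"
        using that assms by auto
      then show ?thesis
        using iff joined_base[OF that] by blast
    qed
    show "(x, y) \<in> joined E (J \<union> M)" if "x \<in> E" "y \<in> E" "?S `` {c x} = ?S `` {c y}" for x y
      using iff that by blast
  qed
  also have "(\<lambda>x. ?S `` {c x}) ` E = ?Q // ?S"
    by (auto simp: quotient_def c_def)
  finally show ?thesis ..
qed

section \<open>Circles in the states of a closed row\<close>

definition state_joins ::
    "('c, 'e) tangle \<Rightarrow> (corner \<times> corner) set \<Rightarrow> ('c \<Rightarrow> split_type) \<Rightarrow> ('e \<times> 'e) set" where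
  "state_joins T P s = (\<lambda>(a, b). (bdry T a, bdry T b)) ` P \<union>
     (\<Union>c\<in>crossings T. (\<lambda>(a, b). (inc T c a, inc T c b)) ` split_pairs (s c))"

lemma num_circles_close_up:
  assumes "disc_diagram T"
  shows "num_circles (state (close_up T P) s) =
    card (edges T // joined (edges T) (state_joins T P s))"
proof -
  define J where "J = (\<lambda>(a, b). (bdry T a, bdry T b)) ` P"
  define M where "M = (\<Union>c\<in>crossings T. (\<lambda>(a, b). (inc T c a, inc T c b)) ` split_pairs (s c))"
  define c where "c = (\<lambda>x. joined (edges T) J `` {x})"
  have sub: "J \<subseteq> edges T \<times> edges T" "M \<subseteq> edges T \<times> edges T"
    using assms by (auto simp: J_def M_def disc_diagram_def)
  have "(\<Union>d\<in>crossings T. (\<lambda>(a, b). (c (inc T d a), c (inc T d b))) ` split_pairs (s d)) =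
      map_prod c c ` M"
    unfolding M_def image_UN image_image by (auto simp: case_prod_unfold)
  then have "num_circles (state (close_up T P) s) =
      card ((edges T // joined (edges T) J) //
        joined (edges T // joined (edges T) J) (map_prod c c ` M))"
    by (simp add: num_circles_def state_def close_up_def join_def J_def c_def)
  also have "\<dots> = card (edges T // joined (edges T) (J \<union> M))"
    using card_iterated_quotient[OF sub] unfolding c_def .
  finally show ?thesis
    by (simp add: state_joins_def J_def M_def)
qed

definition cuts :: "(nat \<Rightarrow> split_type) \<Rightarrow> nat \<Rightarrow> nat" where
  "cuts s i = card {j. j < i \<and> s j = Type1}"

lemma cuts_0 [simp]: "cuts s 0 = 0"
  by (simp add: cuts_def)

lemma cuts_Suc [simp]: "cuts s (Suc i) = cuts s i + (if s i = Type1 then 1 else 0)"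
proof -
  have "{j. j < Suc i \<and> s j = Type1} =
      (if s i = Type1 then insert i {j. j < i \<and> s j = Type1} else {j. j < i \<and> s j = Type1})"
    by (auto simp: less_Suc_eq)
  then show ?thesis
    by (simp add: cuts_def)
qed

lemma cuts_mono: "i \<le> j \<Longrightarrow> cuts s i \<le> cuts s j"
  unfolding cuts_def by (intro card_mono) auto

lemma cuts_image: "cuts s ` {..n} = {..cuts s n}"
  by (induction n) (auto simp: atMost_Suc)

lemma cuts_eq_0_iff: "cuts s n = 0 \<longleftrightarrow> (\<forall>i<n. s i = Type0)"
  by (induction n) (auto simp: less_Suc_eq, (metis split_type.exhaust)+)

definition row_classes ::
    "nat \<Rightarrow> (corner \<times> corner) set \<Rightarrow> (nat \<Rightarrow> split_type) \<Rightarrow> ((level \<times> nat) \<times> (level \<times> nat)) set" where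
  "row_classes n P s = joined (UNIV \<times> {..n}) (state_joins (row n) P s)"

lemma edges_row: "edges (row n) = UNIV \<times> {..n}"
  by (simp add: row_def)

lemma equiv_row_classes: "equiv (UNIV \<times> {..n}) (row_classes n P s)"
  unfolding row_classes_def by (rule equiv_joined)

lemma row_classes_refl: "i \<le> n \<Longrightarrow> ((l, i), (l, i)) \<in> row_classes n P s"
  by (simp add: row_classes_def joined_def)

lemma row_classes_sym: "(x, y) \<in> row_classes n P s \<Longrightarrow> (y, x) \<in> row_classes n P s"
  using equiv_row_classes[of n P s] by (auto simp: equiv_def dest: symD)

lemma row_classes_trans [trans]:
  "(x, y) \<in> row_classes n P s \<Longrightarrow> (y, z) \<in> row_classes n P s \<Longrightarrow> (x, z) \<in> row_classes n P s"
  using equiv_row_classes[of n P s] by (auto simp: equiv_def dest: transD)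

lemma row_classes_outer:
  assumes "(a, b) \<in> P"
  shows "(row_bdry n a, row_bdry n b) \<in> row_classes n P s"
  unfolding row_classes_def
proof (rule joined_base)
  show "row_bdry n a \<in> UNIV \<times> {..n}" for a
    by (cases a) auto
  then show "row_bdry n b \<in> UNIV \<times> {..n}" .
qed (use assms in \<open>force simp: state_joins_def row_def\<close>)

lemma row_classes_Type0:
  "i < n \<Longrightarrow> s i = Type0 \<Longrightarrow> ((l, i), (l, Suc i)) \<in> row_classes n P s"
  unfolding row_classes_def
  by (rule joined_base; cases l) (force simp: state_joins_def row_def)+

lemma row_classes_Type1:
  assumes "i < n" "s i = Type1"
  shows "((Upper, i), (Lower, i)) \<in> row_classes n P s"
    and "((Upper, Suc i), (Lower, Suc i)) \<in> row_classes n P s"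
  unfolding row_classes_def using assms
  by (rule_tac joined_base; force simp: state_joins_def row_def)+

lemma num_circles_row:
  assumes "\<And>a b. (a, b) \<in> P \<Longrightarrow> f (row_bdry n a) = f (row_bdry n b)"
    and "\<And>l i. i < n \<Longrightarrow> s i = Type0 \<Longrightarrow> f (l, Suc i) = f (l, i)"
    and "\<And>i. i < n \<Longrightarrow> s i = Type1 \<Longrightarrow> f (Upper, i) = f (Lower, i)"
    and "\<And>i. i < n \<Longrightarrow> s i = Type1 \<Longrightarrow> f (Upper, Suc i) = f (Lower, Suc i)"
    and "\<And>l i l' j. i \<le> n \<Longrightarrow> j \<le> n \<Longrightarrow> f (l, i) = f (l', j) \<Longrightarrow> ((l, i), (l', j)) \<in> row_classes n P s"
  shows "num_circles (state (close_up (row n) P) s) = card (f ` (UNIV \<times> {..n}))"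
  unfolding num_circles_close_up[OF disc_diagram_row] edges_row
proof (rule card_joined_classes)
  show "f x = f y" if "(x, y) \<in> state_joins (row n) P s" for x y
  proof -
    consider a b where "(a, b) \<in> P" "x = row_bdry n a" "y = row_bdry n b"
      | i a b where "i < n" "(a, b) \<in> split_pairs (s i)" "x = row_inc i a" "y = row_inc i b"
      using \<open>(x, y) \<in> _\<close> by (auto simp: state_joins_def row_def)
    then show ?thesis
    proof cases
      case 2
      then show ?thesis
        using assms(2-4) by (cases "s i") auto
    qed (simp add: assms(1))
  qed
qed (use assms(5) in \<open>auto simp: row_classes_def\<close>)

text \<open>
  Once the two strands are connected at one place, they stay connected to the right of it: a split of
  \<open>Type0\<close> prolongs both of them, and a cut reconnects them.
\<close>

lemma row_classes_levels:
  assumes "((Upper, a), (Lower, a)) \<in> row_classes n P s" "a \<le> i" "i \<le> n"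
  shows "((l, i), (l', i)) \<in> row_classes n P s"
proof -
  have levels: "((Upper, i), (Lower, i)) \<in> row_classes n P s"
    using assms(2,3)
  proof (induction i rule: dec_induct)
    case (step i)
    show ?case
    proof (cases "s i")
      case Type0
      have "((Upper, Suc i), (Upper, i)) \<in> row_classes n P s"
        using Type0 step by (intro row_classes_sym[OF row_classes_Type0]) auto
      also have "((Upper, i), (Lower, i)) \<in> row_classes n P s"
        using step by simp
      also have "((Lower, i), (Lower, Suc i)) \<in> row_classes n P s"
        using Type0 step by (intro row_classes_Type0) auto
      finally show ?thesis .
    qed (use step in \<open>simp add: row_classes_Type1\<close>)
  qed (rule assms(1))
  then show ?thesis
    using levels row_classes_sym[OF levels] row_classes_refl[OF assms(3)] by (cases l; cases l') simp_all
qed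

lemma row_classes_stretch:
  assumes "i \<le> j" "j \<le> n" "cuts s i = cuts s j"
  shows "((l, i), (l, j)) \<in> row_classes n P s"
  using assms
proof (induction j rule: dec_induct)
  case (step j)
  have "cuts s i \<le> cuts s j"
    using step by (intro cuts_mono)
  with step.prems have "s j = Type0" "cuts s i = cuts s j"
    by (cases "s j"; simp)+
  then show ?case
    using step row_classes_trans[OF _ row_classes_Type0] by simp
qed (simp add: row_classes_refl)

text \<open>
  So the number of cuts to the left of an arc determines its class as soon as the strands are
  connected at the left boundary. The outer arc of the twist loop provides this connection at once;
  in the foil it comes from a cut.
\<close>

lemma row_classes_columns:
  assumes "((Upper, 0), (Lower, 0)) \<in> row_classes n P s"
    and "i \<le> n" "j \<le> n" "cuts s i = cuts s j"
  shows "((l, i), (l', j)) \<in> row_classes n P s"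
proof -
  have "((l, i), (l, j)) \<in> row_classes n P s"
    using assms(2-4) row_classes_stretch[of i j] row_classes_sym[OF row_classes_stretch[of j i]]
    by (cases "i \<le> j") auto
  also have "((l, j), (l', j)) \<in> row_classes n P s"
    using assms(1,3) by (rule_tac row_classes_levels) auto
  finally show ?thesis .
qed

lemma num_circles_twist_loop:
  "num_circles (state (twist_loop n) s) = cuts s n + 1"
proof -
  have "num_circles (state (twist_loop n) s) = card ((\<lambda>(l :: level, i). cuts s i) ` (UNIV \<times> {..n}))"
    unfolding twist_loop_def
  proof (rule num_circles_row)
    let ?R = "row_classes n {(NW, SW), (NE, SE)} s"
    have "(row_bdry n NW, row_bdry n SW) \<in> ?R"
      by (rule row_classes_outer) simp
    then show "((l, i), (l', j)) \<in> ?R"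
      if "i \<le> n" "j \<le> n" "(case (l, i) of (l, i) \<Rightarrow> cuts s i) = (case (l', j) of (l, i) \<Rightarrow> cuts s i)"
      for l i l' j
      using that by (rule_tac row_classes_columns) auto
  qed auto
  also have "(\<lambda>(l :: level, i). cuts s i) ` (UNIV \<times> {..n}) = cuts s ` {..n}"
    by force
  finally show ?thesis
    by (simp add: cuts_image)
qed

lemma num_circles_foil_no_cut:
  assumes "cuts s n = 0"
  shows "num_circles (state (foil n) s) = 2"
proof -
  have "num_circles (state (foil n) s) = card (fst ` ((UNIV :: level set) \<times> {..n}))"
    unfolding foil_def
  proof (rule num_circles_row)
    show "((l, i), (l', j)) \<in> row_classes n {(NW, NE), (SW, SE)} s"
      if "i \<le> n" "j \<le> n" "fst (l, i) = fst (l', j)" for l i l' j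
    proof -
      have "cuts s i = 0" "cuts s j = 0"
        using that assms cuts_mono[of i n s] cuts_mono[of j n s] by simp_all
      then show ?thesis
        using that row_classes_stretch[of i j] row_classes_sym[OF row_classes_stretch[of j i]]
        by (cases "i \<le> j") auto
    qed
  qed (use assms in \<open>auto simp: cuts_eq_0_iff\<close>)
  also have "fst ` ((UNIV :: level set) \<times> {..n}) = {Upper, Lower}"
    by (force simp: UNIV_level)
  finally show ?thesis
    by simp
qed

text \<open>
  The outer arcs identify the last stretch, which has \<open>k\<close> cuts to its left, with the first one, which
  has none. Hence the number of cuts modulo \<open>k\<close> is still invariant, and it is complete.
\<close>

lemma num_circles_foil_cut:
  assumes "cuts s n \<noteq> 0"
  shows "num_circles (state (foil n) s) = cuts s n"
proof -
  let ?R = "row_classes n {(NW, NE), (SW, SE)} s"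
  let ?k = "cuts s n"
  have "(row_bdry n NW, row_bdry n NE) \<in> ?R" "(row_bdry n SW, row_bdry n SE) \<in> ?R"
    by (rule row_classes_outer; simp)+
  then have around: "((l, 0), (l, n)) \<in> ?R" for l
    by (cases l) auto
  \<comment> \<open>A cut connects the levels at every arc on its right, hence on the far right, and through the
    outer arcs also on the far left.\<close>
  obtain p where p: "p < n" "s p = Type1"
    using assms by (metis cuts_eq_0_iff split_type.exhaust)
  have "((Upper, 0), (Upper, n)) \<in> ?R"
    by (rule around)
  also have "((Upper, n), (Lower, n)) \<in> ?R"
    by (rule row_classes_levels[of "Suc p"]) (use p in \<open>auto intro: row_classes_Type1\<close>)
  also have "((Lower, n), (Lower, 0)) \<in> ?R"
    by (rule row_classes_sym[OF around])
  finally have col: "((l, i), (l', j)) \<in> ?R" if "i \<le> n" "j \<le> n" "cuts s i = cuts s j" for l l' i j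
    using that by (rule row_classes_columns)
  have glue: "((l, i), (l', j)) \<in> ?R" if "i \<le> n" "j \<le> n" "cuts s i = 0" "cuts s j = ?k" for l l' i j
  proof -
    have "((l, i), (l, 0)) \<in> ?R"
      using that by (intro col) auto
    also have "((l, 0), (l, n)) \<in> ?R"
      by (rule around)
    also have "((l, n), (l', j)) \<in> ?R"
      using that by (intro col) auto
    finally show ?thesis .
  qed
  have "num_circles (state (foil n) s) =
      card ((\<lambda>(l :: level, i). cuts s i mod ?k) ` (UNIV \<times> {..n}))"
    unfolding foil_def
  proof (rule num_circles_row)
    show "((l, i), (l', j)) \<in> ?R"
      if "i \<le> n" "j \<le> n"
        "(case (l, i) of (l, i) \<Rightarrow> cuts s i mod ?k) = (case (l', j) of (l, i) \<Rightarrow> cuts s i mod ?k)"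
      for l i l' j
    proof -
      have le: "cuts s i \<le> ?k" "cuts s j \<le> ?k"
        using that by (simp_all add: cuts_mono)
      moreover have "cuts s i mod ?k = cuts s j mod ?k"
        using that(3) by simp
      ultimately consider "cuts s i = cuts s j" | "cuts s i = 0" "cuts s j = ?k"
        | "cuts s j = 0" "cuts s i = ?k"
        by (cases "cuts s i = ?k"; cases "cuts s j = ?k") auto
      then show ?thesis
        using that(1,2) by cases (simp_all add: col glue row_classes_sym[OF glue])
    qed
  qed auto
  also have "(\<lambda>(l :: level, i). cuts s i mod ?k) ` (UNIV \<times> {..n}) = (\<lambda>m. m mod ?k) ` cuts s ` {..n}"
    by force
  also have "\<dots> = {..<?k}"
  proof
    show "{..<?k} \<subseteq> (\<lambda>m. m mod ?k) ` cuts s ` {..n}"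
    proof
      show "m \<in> (\<lambda>m. m mod ?k) ` cuts s ` {..n}" if "m \<in> {..<?k}" for m
        using that unfolding cuts_image by (intro rev_image_eqI[of m]) auto
    qed
  qed (use assms in auto)
  finally show ?thesis
    by simp
qed

section \<open>The generating polynomials\<close>

lemma crossings_close_up_row: "crossings (close_up (row n) P) = {..<n}"
  by (simp add: close_up_def join_def row_def)

lemma monom_cuts: "monom 1 (cuts s n) = (\<Prod>i<n. if s i = Type1 then [:0, 1:] else (1 :: int poly))"
  by (induction n) (simp_all add: monom_Suc mult.commute)

text \<open>
  Each crossing contributes independently a factor \<open>x\<close> if it is cut and \<open>1\<close> otherwise, so the sum over
  all states is the expansion of a product of \<open>n\<close> equal factors.
\<close>

lemma sum_monom_cuts:
  "(\<Sum>s\<in>{..<n} \<rightarrow>\<^sub>E UNIV. monom 1 (cuts s n)) = ([:0, 1:] + 1 :: int poly) ^ n"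
proof -
  have UNIV_split: "UNIV = {Type0, Type1}"
    using split_type.exhaust by auto
  have "([:0, 1:] + 1 :: int poly) ^ n = (\<Prod>i<n. \<Sum>t\<in>UNIV. if t = Type1 then [:0, 1:] else 1)"
    by (simp add: UNIV_split add.commute)
  also have "\<dots> = (\<Sum>s\<in>{..<n} \<rightarrow>\<^sub>E UNIV. \<Prod>i<n. if s i = Type1 then [:0, 1:] else 1)"
    by (rule prod_sum_PiE) (simp_all add: UNIV_split)
  finally show ?thesis
    by (simp add: monom_cuts)
qed

lemma gen_poly_twist_loop: "gen_poly (twist_loop n) = [:0, 1:] * ([:0, 1:] + 1) ^ n"
proof -
  have "gen_poly (twist_loop n) = (\<Sum>s\<in>{..<n} \<rightarrow>\<^sub>E UNIV. [:0, 1:] * monom 1 (cuts s n))"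
    unfolding gen_poly_def num_circles_twist_loop
    by (simp add: twist_loop_def crossings_close_up_row monom_Suc)
  then show ?thesis
    by (simp only: sum_distrib_left[symmetric] sum_monom_cuts)
qed

lemma gen_poly_foil: "gen_poly (foil n) = ([:0, 1:] + 1) ^ n + [:0, 1:] ^ 2 - 1"
proof -
  let ?S = "{..<n} \<rightarrow>\<^sub>E (UNIV :: split_type set)"
  let ?u = "\<lambda>i\<in>{..<n}. Type0"
  have fin: "finite ?S"
  proof (rule finite_PiE)
    have "(UNIV :: split_type set) = {Type0, Type1}"
      using split_type.exhaust by auto
    then show "finite (UNIV :: split_type set)"
      by (metis finite.emptyI finite_insert)
  qed simp
  have uncut: "cuts s n = 0 \<longleftrightarrow> s = ?u" if "s \<in> ?S" for s
    using that by (auto simp: cuts_eq_0_iff fun_eq_iff PiE_def extensional_def)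
  \<comment> \<open>The uncut state has two circles, while its number of cuts accounts for \<open>x^0 = 1\<close> only.\<close>
  have circles: "monom 1 (num_circles (state (foil n) s)) =
      monom 1 (cuts s n) + (if s = ?u then [:0, 1:] ^ 2 - 1 else (0 :: int poly))" if "s \<in> ?S" for s
    using uncut[OF that]
    by (cases "s = ?u")
      (simp_all add: num_circles_foil_no_cut num_circles_foil_cut monom_altdef)
  have "gen_poly (foil n) = (\<Sum>s\<in>?S. monom 1 (num_circles (state (foil n) s)))"
    by (simp add: gen_poly_def foil_def crossings_close_up_row)
  also have "\<dots> = (\<Sum>s\<in>?S. monom 1 (cuts s n)) + (\<Sum>s\<in>?S. if s = ?u then [:0, 1:] ^ 2 - 1 else 0)"
    by (simp add: circles sum.distrib)
  also have "(\<Sum>s\<in>?S. if s = ?u then [:0, 1:] ^ 2 - 1 else 0) = ([:0, 1:] ^ 2 - 1 :: int poly)"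
    using sum.delta[OF fin, of ?u "\<lambda>_. [:0, 1:] ^ 2 - 1"] by simp
  finally show ?thesis
    by (simp add: sum_monom_cuts)
qed

theorem theorem39:
  fixes n :: nat
  shows "(n \<ge> 1 \<longrightarrow> gen_poly (foil n) = gen_poly (foil (n - 1)) + gen_poly (twist_loop (n - 1)))
    \<and> gen_poly (foil n) = ([:0, 1:] + 1) ^ n + [:0, 1:] ^ 2 - 1"
proof (intro conjI impI)
  assume "n \<ge> 1"
  then obtain m where n: "n = Suc m"
    by (cases n) auto
  show "gen_poly (foil n) = gen_poly (foil (n - 1)) + gen_poly (twist_loop (n - 1))"
    unfolding gen_poly_foil gen_poly_twist_loop n
    by (simp only: diff_Suc_1 power_Suc distrib_right mult_1 diff_conv_add_uminus ac_simps)
qed (rule gen_poly_foil)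

end
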